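(* Let $r=\sqrt{1-2t}$. As formal power series, \[ \sum_{n=0}^{\infty}\sum_{\pi\in\mathfrak{J}_{n}}t^{\operatorname{asc}(\pi)}\frac{x^{n}}{n!}=1+\frac{2(e^{rx}-1)}{1+r+(r-1)e^{rx}}. \]
   Context: A permutation of a finite set $S$ of positive integers is a word $\pi=\pi_1\pi_2\cdots\pi_n$ ($n=|S|$) in which each element of $S$ appears exactly once; the empty word is the unique permutation of the empty set. $\mathfrak{S}_n$ denotes the set of permutations of $\{1,\dots,n\}$. For a permutation $\pi$ of $S$ and a letter $x$ of $\pi$, let $\rho_\pi(x)$ be the maximal consecutive subword of $\pi$ consisting of the letters immediately to the right of $x$ that are all larger than $x$. A permutation $\pi$ is Jacobi if $|\rho_\pi(x)|$ is even for every letter $x$ of $\pi$. $\mathfrak{J}_n$ is the set of Jacobi permutations in $\mathfrak{S}_n$ (so $\mathfrak{J}_0$ consists of the empty permutation). An ascent of $\pi\in\mathfrak{S}_n$ is an index $k\in[n-1]$ with $\pi_k<\pi_{k+1}$, and $\operatorname{asc}(\pi)$ is the number of ascents. *)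

theory Defs
  imports
    Complex_Main
    "HOL-Computational_Algebra.Formal_Power_Series"
    "HOL-Combinatorics.Multiset_Permutations"
begin

definition rho :: "nat list \<Rightarrow> nat \<Rightarrow> nat list" where
  "rho p x = takeWhile (\<lambda>y. x < y) (tl (dropWhile (\<lambda>y. y \<noteq> x) p))"

definition jacobi :: "nat list \<Rightarrow> bool" where
  "jacobi p \<longleftrightarrow> (\<forall>x\<in>set p. even (length (rho p x)))"

definition jacobi_perms :: "nat \<Rightarrow> nat list set" where
  "jacobi_perms n = {p \<in> permutations_of_set {1..n}. jacobi p}"

text \<open>Lists are indexed from 0, so the letter in position \<open>k\<close> of a word \<open>p\<close> is \<open>p ! (k - 1)\<close>.\<close>

definition asc :: "nat list \<Rightarrow> nat" where
  "asc p = card {k \<in> {1..<length p}. p ! (k - 1) < p ! k}"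

text \<open>
  The variable \<open>t\<close> is \<open>fps_X :: real fps\<close>, and series in \<open>x\<close> are elements of \<open>real fps fps\<close>,
  that is, of the ring of power series in \<open>x\<close> over the ring of power series in \<open>t\<close>.
  In particular \<open>fps_exp r :: real fps fps\<close> is the series of \<open>exp (r x)\<close>. The lemmas below
  confirm that the library operations used at these types, where the coefficient ring is not a
  field, have their intended meaning.
\<close>

lemma fps_radical_square:
  includes fps_syntax
  shows "(fps_radical root 2 (1 - 2 * fps_X) :: real fps) ^ 2 = 1 - 2 * fps_X"
proof -
  have "(1 - 2 * fps_X :: real fps) $ 0 = 1" by simp
  then show ?thesis
    using power_radical[of "1 - 2 * fps_X :: real fps" root 1]
    by (simp add: numeral_2_eq_2)
qed

lemma fps_divide_fact:
  "(a :: real fps) / fact n = fps_const (1 / fact n) * a"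
proof -
  have "(fact n :: real fps) = fps_const (fact n)"
    by (metis fps_of_nat of_nat_fact)
  then show ?thesis
    by (simp add: fps_divide_unit fps_const_inverse divide_inverse mult.commute)
qed

lemma fps_exp_nth_fps:
  includes fps_syntax
  shows "fps_exp (r :: real fps) $ n = fps_const (1 / fact n) * r ^ n"
  using fps_divide_fact[of "r ^ n" n] by (simp add: fps_exp_def)

lemma fps_fps_divide_unit:
  includes fps_syntax
  fixes f g :: "real fps fps"
  assumes "g $ 0 $ 0 \<noteq> 0"
  shows "f / g * g = f"
proof -
  have "g $ 0 \<noteq> 0" using assms by auto
  moreover have "inverse (g $ 0) * g $ 0 = 1"
    using assms by (simp add: inverse_mult_eq_1)
  then have "g * inverse g = 1"
    using fps_right_inverse[of g "inverse (g $ 0)"] fps_inverse_def[of g]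
    by (simp only: mult.commute[of "g $ 0"])
  ultimately show ?thesis
    by (simp add: fps_divide_unit mult.assoc mult.commute[of "inverse g"])
qed

lemma denominator_nth_0_0:
  includes fps_syntax
  assumes "r = fps_radical root 2 (1 - 2 * fps_X :: real fps)"
  shows "(1 + fps_const r + (fps_const r - 1) * fps_exp r) $ 0 $ 0 = 2"
  using assms by (simp add: fps_exp_nth_fps)

end

theory Submission
  imports Defs
begin

unbundle fps_syntax

text \<open>
  Splitting a permutation at its smallest letter, \<open>p = s m u\<close>, the word \<open>p\<close> is Jacobi iff \<open>s\<close>
  and \<open>u\<close> are and \<open>length u\<close> is even, while \<open>asc p = asc s + asc u + [u \<noteq> []]\<close>. Hence the generating
  function \<open>J\<close> satisfies \<open>J' = J (1 - t + t E)\<close>, where \<open>E\<close> is the even part of \<open>J\<close>. As the second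
  factor is even, \<open>J(x) J(-x)\<close> has derivative zero and is therefore \<open>1\<close>; multiplying out,
  \<open>2 J' = (2 - 2 t) J + t (J\<^sup>2 + 1)\<close>. This Riccati equation has only one solution with constant
  term \<open>1\<close>, and the closed form is one.
\<close>

section \<open>Splitting at the smallest letter\<close>

lemma asc_Nil [simp]: "asc [] = 0"
  by (simp add: asc_def)

lemma asc_singleton [simp]: "asc [x] = 0"
  by (simp add: asc_def)

lemma asc_Cons_Cons [simp]: "asc (x # y # zs) = (if x < y then 1 else 0) + asc (y # zs)"
proof -
  have sum_eq: "asc p = (\<Sum>k = 1..<length p. if p ! (k - 1) < p ! k then 1 else 0)" for p
    by (simp add: asc_def sum.If_cases Int_def)
  have "asc (x # y # zs) = (if x < y then 1 else 0) +
      (\<Sum>k = Suc 1..<Suc (length (y # zs)).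
         if (x # y # zs) ! (k - 1) < (x # y # zs) ! k then 1 else 0)"
    unfolding sum_eq by (subst sum.atLeast_Suc_lessThan) simp_all
  also have "(\<Sum>k = Suc 1..<Suc (length (y # zs)).
         if (x # y # zs) ! (k - 1) < (x # y # zs) ! k then 1 else (0::nat)) = asc (y # zs)"
    unfolding sum_eq sum.shift_bounds_Suc_ivl
    by (rule sum.cong) (auto simp: nth_Cons')
  finally show ?thesis .
qed

text \<open>A step into \<open>m\<close> is never an ascent, and the step out of \<open>m\<close> is
  one as soon as \<open>u\<close> is nonempty.\<close>

lemma asc_append_min:
  assumes "\<forall>y\<in>set s. m < y" "\<forall>y\<in>set u. m < y"
  shows "asc (s @ m # u) = asc s + asc u + (if u = [] then 0 else 1)"
  using assms
proof (induction s)
  case Nil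
  then show ?case by (cases u) auto
next
  case (Cons a s)
  then show ?case by (cases s) auto
qed

text \<open>As \<open>m < x\<close>, the run to the right of \<open>x\<close> stops at
  \<open>m\<close> at the latest, so it never leaves \<open>s\<close>.\<close>

lemma rho_append_min_left:
  assumes "x \<in> set s" "m < x"
  shows "rho (s @ m # u) x = rho s x"
proof -
  obtain ys zs where s: "s = ys @ x # zs" "x \<notin> set ys"
    using split_list_first[OF assms(1)] by blast
  then have "dropWhile (\<lambda>y. y \<noteq> x) (s @ w) = x # zs @ w" for w
    by (induction ys arbitrary: s) auto
  from this[of "m # u"] this[of "[]"] show ?thesis
    using assms(2) by (auto simp: rho_def takeWhile_append takeWhile_eq_all_conv[THEN iffD2])
qed

lemma rho_append_right:
  assumes "x \<notin> set s" "x \<noteq> m"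
  shows "rho (s @ m # u) x = rho u x"
  using assms by (induction s) (auto simp: rho_def)

lemma rho_min:
  assumes "m \<notin> set s" "\<forall>y\<in>set u. m < y"
  shows "rho (s @ m # u) m = u"
proof -
  have "rho (s @ m # u) m = takeWhile (\<lambda>y. m < y) u"
    using assms(1) by (induction s) (auto simp: rho_def)
  then show ?thesis using assms(2) by (simp add: takeWhile_eq_all_conv)
qed

text \<open>The run of \<open>m\<close> is all of \<open>u\<close>; every other run stays in its own
  factor. Since \<open>rho\<close> looks at the first occurrence of a letter, letters of
  \<open>u\<close> must not occur in \<open>s\<close>.\<close>

lemma jacobi_append_min:
  assumes "\<forall>y\<in>set s. m < y" "\<forall>y\<in>set u. m < y" "set s \<inter> set u = {}"
  shows "jacobi (s @ m # u) \<longleftrightarrow> jacobi s \<and> jacobi u \<and> even (length u)"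
proof -
  have "m \<notin> set s" "m \<notin> set u" using assms by auto
  then have "rho (s @ m # u) m = u"
    and "\<forall>x\<in>set s. rho (s @ m # u) x = rho s x"
    and "\<forall>x\<in>set u. rho (s @ m # u) x = rho u x"
    using assms by (auto intro!: rho_min rho_append_min_left rho_append_right)
  moreover have "set (s @ m # u) = insert m (set s \<union> set u)" by simp
  ultimately show ?thesis by (simp add: jacobi_def ball_Un) blast
qed

section \<open>The recurrence for the ascent polynomials\<close>

text \<open>Arbitrary letter sets are allowed because the two factors of a split word are
  permutations of complementary subsets.\<close>

definition jacobi_perms_of_set :: "nat set \<Rightarrow> nat list set" where
  "jacobi_perms_of_set S = {p \<in> permutations_of_set S. jacobi p}"

definition asc_poly :: "nat set \<Rightarrow> real fps" where
  "asc_poly S = (\<Sum>p\<in>jacobi_perms_of_set S. fps_X ^ asc p)"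

text \<open>The contribution of \<open>m\<close> to \<open>s m u\<close> when \<open>length u = k\<close>.\<close>

definition min_weight :: "nat \<Rightarrow> real fps" where
  "min_weight k = (if k = 0 then 1 else if even k then fps_X else 0)"

lemma finite_jacobi_perms_of_set [simp]: "finite (jacobi_perms_of_set S)"
  by (simp add: jacobi_perms_of_set_def)

lemma length_jacobi_perms_of_set: "p \<in> jacobi_perms_of_set S \<Longrightarrow> length p = card S"
  by (auto simp: jacobi_perms_of_set_def permutations_of_set_def distinct_card)

lemma asc_poly_empty [simp]: "asc_poly {} = 1"
proof -
  have "jacobi_perms_of_set {} = {[]}"
    by (auto simp: jacobi_perms_of_set_def jacobi_def)
  then show ?thesis by (simp add: asc_poly_def)
qed

text \<open>\<open>A\<close> is the set of letters to the right of \<open>m\<close>; it and the two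
  factors determine the word.\<close>

lemma asc_poly_insert_min:
  assumes "finite T" "\<forall>y\<in>T. m < y"
  shows "asc_poly (insert m T) =
    (\<Sum>A\<in>Pow T. asc_poly (T - A) * (min_weight (card A) * asc_poly A))"
proof -
  let ?J = jacobi_perms_of_set
  let ?E = "\<lambda>A. {u \<in> ?J A. even (length u)}"
  have m: "m \<notin> T" using assms by auto
  have "asc_poly (insert m T) =
      (\<Sum>(A, s, u)\<in>(SIGMA A:Pow T. ?J (T - A) \<times> ?E A). fps_X ^ asc (s @ m # u))"
    unfolding asc_poly_def
  proof (rule sum.reindex_bij_witness[where
        i = "\<lambda>(A, s, u). s @ m # u" and
        j = "\<lambda>p. (set (tl (dropWhile (\<lambda>y. y \<noteq> m) p)), takeWhile (\<lambda>y. y \<noteq> m) p,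
              tl (dropWhile (\<lambda>y. y \<noteq> m) p))"], goal_cases)
    case (1 p)
    then have "m \<in> set p" by (auto simp: jacobi_perms_of_set_def permutations_of_set_def)
    then obtain s u where p: "p = s @ m # u" "m \<notin> set s" by (metis split_list_first)
    then have "takeWhile (\<lambda>y. y \<noteq> m) p = s" "dropWhile (\<lambda>y. y \<noteq> m) p = m # u"
      by (auto simp: takeWhile_append dropWhile_append)
    then show ?case using p by simp
  next
    case (2 p)
    then have pT: "set p = insert m T" "distinct p" "jacobi p"
      by (auto simp: jacobi_perms_of_set_def permutations_of_set_def)
    then obtain s u where p: "p = s @ m # u" "m \<notin> set s" by (metis split_list_first insertI1)
    have eqs: "takeWhile (\<lambda>y. y \<noteq> m) p = s" "dropWhile (\<lambda>y. y \<noteq> m) p = m # u"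
      using p by (auto simp: takeWhile_append dropWhile_append)
    have mu: "m \<notin> set u" and d: "distinct s" "distinct u" "set s \<inter> set u = {}"
      using p pT by auto
    then have T: "T = set s \<union> set u" using pT p m by auto
    have "jacobi s \<and> jacobi u \<and> even (length u)"
      using pT(3) d(3) assms(2) unfolding p T by (subst (asm) jacobi_append_min) auto
    then show ?case unfolding eqs using T d
      by (auto simp: jacobi_perms_of_set_def permutations_of_set_def)
  next
    case (3 a)
    then obtain A s u where a: "a = (A, s, u)" "A \<subseteq> T" "s \<in> ?J (T - A)" "u \<in> ?J A"
      by auto
    then have "m \<notin> set s" "set u = A"
      using m by (auto simp: jacobi_perms_of_set_def permutations_of_set_def)
    then show ?case using a by (auto simp: takeWhile_append dropWhile_append)
  next
    case (4 a)
    then obtain A s u where a: "a = (A, s, u)" "A \<subseteq> T" "s \<in> ?J (T - A)" "u \<in> ?J A"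
      and ev: "even (length u)" by auto
    then have *: "set s = T - A" "set u = A" "distinct s" "distinct u" "jacobi s" "jacobi u"
      by (auto simp: jacobi_perms_of_set_def permutations_of_set_def)
    then have "jacobi (s @ m # u)"
      using a(2) assms(2) ev by (subst jacobi_append_min) auto
    then show ?case unfolding a using * a(2) m
      by (auto simp: jacobi_perms_of_set_def permutations_of_set_def)
  next
    case (5 p)
    then have "m \<in> set p" by (auto simp: jacobi_perms_of_set_def permutations_of_set_def)
    then obtain s u where p: "p = s @ m # u" "m \<notin> set s" by (metis split_list_first)
    then have "takeWhile (\<lambda>y. y \<noteq> m) p = s" "dropWhile (\<lambda>y. y \<noteq> m) p = m # u"
      by (auto simp: takeWhile_append dropWhile_append)
    then show ?case using p by simp
  qed
  also have "\<dots> = (\<Sum>A\<in>Pow T. \<Sum>(s, u)\<in>?J (T - A) \<times> ?E A. fps_X ^ asc (s @ m # u))"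
    using assms(1) by (subst sum.Sigma) auto
  also have "\<dots> = (\<Sum>A\<in>Pow T. asc_poly (T - A) * (min_weight (card A) * asc_poly A))"
  proof (rule sum.cong[OF refl])
    fix A assume A: "A \<in> Pow T"
    have "(\<Sum>(s, u)\<in>?J (T - A) \<times> ?E A. fps_X ^ asc (s @ m # u) :: real fps) =
        (\<Sum>(s, u)\<in>?J (T - A) \<times> ?E A. fps_X ^ asc s * (min_weight (card A) * fps_X ^ asc u))"
    proof (rule sum.cong[OF refl], clarify)
      fix s u assume *: "s \<in> ?J (T - A)" "u \<in> ?J A" "even (length u)"
      then have "set s = T - A" "set u = A" "length u = card A"
        by (auto simp: jacobi_perms_of_set_def permutations_of_set_def distinct_card)
      then have "asc (s @ m # u) = asc s + asc u + (if u = [] then 0 else 1)"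
        using assms(2) A by (intro asc_append_min) auto
      moreover have "min_weight (card A) = fps_X ^ (if u = [] then 0 else 1)"
        using * unfolding \<open>length u = card A\<close>[symmetric] by (auto simp: min_weight_def)
      ultimately show "fps_X ^ asc (s @ m # u) =
          (fps_X ^ asc s * (min_weight (card A) * fps_X ^ asc u) :: real fps)"
        by (simp add: power_add mult_ac)
    qed
    also have "\<dots> = asc_poly (T - A) * (min_weight (card A) * (\<Sum>u\<in>?E A. fps_X ^ asc u))"
      unfolding asc_poly_def sum_distrib_left[of "min_weight _"] sum_product
      by (simp add: sum.cartesian_product)
    \<comment> \<open>All words on \<open>A\<close> have length \<open>card A\<close>, so the parity
      condition holds for all of them or for none; in the latter case the weight is 0.\<close>
    also have "min_weight (card A) * (\<Sum>u\<in>?E A. fps_X ^ asc u) =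
        min_weight (card A) * asc_poly A"
    proof (cases "even (card A)")
      case True
      then have "?E A = ?J A" using length_jacobi_perms_of_set by auto
      then show ?thesis by (simp add: asc_poly_def)
    next
      case False
      then show ?thesis by (auto simp: min_weight_def)
    qed
    finally show "(\<Sum>(s, u)\<in>?J (T - A) \<times> ?E A. fps_X ^ asc (s @ m # u)) =
        asc_poly (T - A) * (min_weight (card A) * asc_poly A)" .
  qed
  finally show ?thesis .
qed

lemma sum_Pow_card:
  fixes f :: "nat \<Rightarrow> 'a::comm_semiring_1"
  assumes "finite T"
  shows "(\<Sum>A\<in>Pow T. f (card A)) = (\<Sum>k\<le>card T. of_nat (card T choose k) * f k)"
proof -
  have "(\<Sum>A\<in>Pow T. f (card A)) =
      (\<Sum>k\<le>card T. \<Sum>A | A \<in> Pow T \<and> card A = k. f (card A))"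
    using assms by (intro sum.group[symmetric]) (auto intro: card_mono)
  also have "\<dots> = (\<Sum>k\<le>card T. of_nat (card T choose k) * f k)"
    using assms by (intro sum.cong refl) (simp add: n_subsets)
  finally show ?thesis .
qed

abbreviation jacobi_poly :: "nat \<Rightarrow> real fps" where
  "jacobi_poly n \<equiv> asc_poly {1..n}"

text \<open>Once the polynomials of subsets depend on size only, the sum over subsets collapses to a
  binomial sum. The third assumption is the induction hypothesis of the next lemma.\<close>

lemma asc_poly_recurrence:
  assumes "finite T" "\<forall>y\<in>T. m < y"
    and "\<And>A. A \<subseteq> T \<Longrightarrow> asc_poly A = jacobi_poly (card A)"
  shows "asc_poly (insert m T) = (\<Sum>k\<le>card T. of_nat (card T choose k) *
    (jacobi_poly (card T - k) * (min_weight k * jacobi_poly k)))"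
proof -
  have "asc_poly (insert m T) = (\<Sum>A\<in>Pow T. jacobi_poly (card T - card A) *
      (min_weight (card A) * jacobi_poly (card A)))"
    unfolding asc_poly_insert_min[OF assms(1,2)]
    using assms by (intro sum.cong refl) (simp add: card_Diff_subset finite_subset)
  also have "\<dots> = (\<Sum>k\<le>card T. of_nat (card T choose k) *
      (jacobi_poly (card T - k) * (min_weight k * jacobi_poly k)))"
    using assms(1) by (rule sum_Pow_card)
  finally show ?thesis .
qed

text \<open>No words are relabelled: sets of equal size satisfy the same recurrence, so strong
  induction on the size suffices.\<close>

lemma asc_poly_eq_jacobi_poly:
  assumes "finite S"
  shows "asc_poly S = jacobi_poly (card S)"
  using assms
proof (induction "card S" arbitrary: S rule: less_induct)
  case less
  \<comment> \<open>Stated for any \<open>U\<close> of the size of \<open>S\<close>, so that it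
    serves both \<open>S\<close> and \<open>{1..Suc n}\<close>.\<close>
  have rec: "asc_poly U = (\<Sum>k\<le>n. of_nat (n choose k) *
      (jacobi_poly (n - k) * (min_weight k * jacobi_poly k)))"
    if "finite U" "card U = Suc n" "card U = card S" for U n
  proof -
    define T where "T = U - {Min U}"
    have "U \<noteq> {}" using that by auto
    then have U: "U = insert (Min U) T"
      using that(1) unfolding T_def by (simp add: insert_absorb)
    have T: "finite T" "card T = n" using that \<open>U \<noteq> {}\<close> by (auto simp: T_def)
    have "\<forall>y\<in>T. Min U < y"
      using that(1) by (auto simp: T_def order.strict_iff_order)
    moreover have "asc_poly A = jacobi_poly (card A)" if "A \<subseteq> T" for A
    proof (rule less.hyps)
      show "card A < card S"
        using card_mono[OF T(1) that] T \<open>card U = Suc n\<close> \<open>card U = card S\<close> by simp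
      show "finite A" using that T finite_subset by blast
    qed
    ultimately show ?thesis
      using asc_poly_recurrence[of T "Min U"] U T by simp
  qed
  show ?case
  proof (cases "card S")
    case 0
    then show ?thesis using less.prems by simp
  next
    case (Suc n)
    then show ?thesis using rec[of S n] rec[of "{1..Suc n}" n] less.prems by simp
  qed
qed

lemma jacobi_poly_Suc:
  "jacobi_poly (Suc n) = (\<Sum>k\<le>n. of_nat (n choose k) *
    (jacobi_poly (n - k) * (min_weight k * jacobi_poly k)))"
proof -
  have "asc_poly A = jacobi_poly (card A)" if "A \<subseteq> {2..Suc n}" for A
    using that by (intro asc_poly_eq_jacobi_poly) (rule finite_subset, auto)
  then have "asc_poly (insert 1 {2..Suc n}) = (\<Sum>k\<le>n. of_nat (n choose k) *
      (jacobi_poly (n - k) * (min_weight k * jacobi_poly k)))"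
    using asc_poly_recurrence[of "{2..Suc n}" 1] by simp
  moreover have "{1..Suc n} = insert 1 {2..Suc n}" by auto
  ultimately show ?thesis by (simp only:)
qed

section \<open>The differential equation\<close>

text \<open>Multiplying by a constant series replaces division by \<open>fact n\<close>, as the
  coefficient ring is not a field.\<close>

definition jacobi_gf :: "real fps fps" where
  "jacobi_gf = Abs_fps (\<lambda>n. fps_const (1 / fact n) * jacobi_poly n)"

lemma jacobi_gf_nth_0: "jacobi_gf $ 0 = 1"
  by (simp add: jacobi_gf_def)

lemma of_nat_fps_const: "(of_nat n :: 'a::comm_ring_1 fps) = fps_const (of_nat n)"
  by (rule fps_of_nat[symmetric])

text \<open>A binomial convolution is a product of exponential generating functions. The second
  factor is 1 - t + t E, with E the even part of \<open>jacobi_gf\<close>.\<close>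

lemma deriv_jacobi_gf:
  "fps_deriv jacobi_gf = jacobi_gf * Abs_fps (\<lambda>k. min_weight k * jacobi_gf $ k)"
proof (rule fps_ext)
  fix n
  have "fps_deriv jacobi_gf $ n = fps_const (1 / fact n) * jacobi_poly (Suc n)"
    by (simp add: jacobi_gf_def of_nat_fps_const mult.assoc[symmetric] field_simps
        del: of_nat_Suc fps_const_mult_apply_left)
  also have "\<dots> = (\<Sum>k\<le>n. jacobi_gf $ (n - k) * (min_weight k * jacobi_gf $ k))"
    unfolding jacobi_poly_Suc sum_distrib_left
  proof (rule sum.cong[OF refl])
    fix k assume "k \<in> {..n}"
    then have "real (n choose k) = fact n / (fact k * fact (n - k))"
      by (simp add: binomial_fact)
    then have "fps_const (1 / fact n) * (of_nat (n choose k) :: real fps) =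
        fps_const (1 / fact (n - k)) * fps_const (1 / fact k)"
      by (simp add: of_nat_fps_const mult.commute)
    then show "fps_const (1 / fact n) * (of_nat (n choose k) *
        (jacobi_poly (n - k) * (min_weight k * jacobi_poly k))) =
        jacobi_gf $ (n - k) * (min_weight k * jacobi_gf $ k)"
      unfolding jacobi_gf_def fps_nth_Abs_fps by algebra
  qed
  also have "\<dots> = (jacobi_gf * Abs_fps (\<lambda>k. min_weight k * jacobi_gf $ k)) $ n"
    unfolding mult.commute[of jacobi_gf "Abs_fps _"] fps_mult_nth atLeast0AtMost
    by (simp add: mult_ac)
  finally show "fps_deriv jacobi_gf $ n =
    (jacobi_gf * Abs_fps (\<lambda>k. min_weight k * jacobi_gf $ k)) $ n" .
qed

lemma fps_nth_compose_uminus_X: "(f oo - fps_X) $ n = (- 1) ^ n * (f $ n :: 'a::comm_ring_1)"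
  using fps_nth_compose_linear[of f "-1" n]
  by (simp add: fps_const_neg[symmetric] del: fps_const_neg)

lemma jacobi_gf_mult_reflect: "jacobi_gf * (jacobi_gf oo - fps_X) = 1"
proof -
  define A where "A = Abs_fps (\<lambda>k. min_weight k * jacobi_gf $ k)"
  define K where "K = (jacobi_gf oo - fps_X)"
  \<comment> \<open>Composition with \<open>- fps_X\<close> substitutes -x for x, and the odd
    coefficients of \<open>A\<close> vanish.\<close>
  have "A oo - fps_X = A"
    by (rule fps_ext) (auto simp: fps_nth_compose_uminus_X A_def min_weight_def)
  then have "fps_deriv K = - (K * A)"
    unfolding K_def using deriv_jacobi_gf
    by (simp add: fps_compose_deriv fps_compose_mult_distrib A_def[symmetric])
  then have "fps_deriv (jacobi_gf * K) = 0"
    using deriv_jacobi_gf by (simp add: A_def[symmetric] algebra_simps)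
  then have "jacobi_gf * K = fps_const ((jacobi_gf * K) $ 0)"
    by (rule fps_deriv_eq_0_iff[THEN iffD1])
  also have "\<dots> = 1"
    by (simp add: K_def jacobi_gf_nth_0 fps_nth_compose_uminus_X)
  finally show ?thesis by (simp add: K_def)
qed

lemma jacobi_gf_riccati:
  "2 * fps_deriv jacobi_gf =
    (2 - 2 * fps_const fps_X) * jacobi_gf + fps_const fps_X * (jacobi_gf\<^sup>2 + 1)"
proof -
  define A where "A = Abs_fps (\<lambda>k. min_weight k * jacobi_gf $ k)"
  define K where "K = (jacobi_gf oo - fps_X)"
  \<comment> \<open>Here \<open>jacobi_gf + K\<close> is twice the even part. Multiplying by
    \<open>jacobi_gf\<close> and using \<open>jacobi_gf * K = 1\<close> then eliminates
    \<open>K\<close>.\<close>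
  have "2 * A = 2 - 2 * fps_const fps_X + fps_const fps_X * (jacobi_gf + K)"
  proof (rule fps_ext)
    fix n
    show "(2 * A) $ n = (2 - 2 * fps_const fps_X + fps_const fps_X * (jacobi_gf + K)) $ n"
      by (auto simp: A_def K_def min_weight_def fps_nth_compose_uminus_X jacobi_gf_nth_0
          numeral_fps_const algebra_simps)
  qed
  moreover have "fps_deriv jacobi_gf = jacobi_gf * A"
    by (simp add: A_def deriv_jacobi_gf)
  moreover have "jacobi_gf * K = 1"
    by (simp add: K_def jacobi_gf_mult_reflect)
  ultimately show ?thesis by algebra
qed

section \<open>Uniqueness of the solution\<close>

lemma fps_linear_ode_eq_0:
  fixes f :: "'a::{idom, semiring_char_0} fps"
  assumes "c * fps_deriv f = f * g" "c = fps_const a" "a \<noteq> 0" "f $ 0 = 0"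
  shows "f = 0"
proof (rule fps_ext)
  fix n
  show "f $ n = 0 $ n"
  proof (induction n rule: less_induct)
    case (less n)
    show ?case
    proof (cases n)
      case 0
      then show ?thesis using assms by simp
    next
      case (Suc k)
      \<comment> \<open>Coefficient \<open>k\<close> of the product involves only
        \<open>f $ 0\<close> to \<open>f $ k\<close>, which vanish by induction, while the left-hand
        side carries \<open>f $ Suc k\<close>.\<close>
      have "(f * g) $ k = 0"
        unfolding fps_mult_nth using less Suc by (intro sum.neutral) auto
      then have "a * (of_nat (Suc k) * f $ Suc k) = 0"
        using arg_cong[OF assms(1), of "\<lambda>h. h $ k"] assms(2) by (simp del: of_nat_Suc)
      then show ?thesis using assms(3) Suc by (simp del: of_nat_Suc)
    qed
  qed
qed

text \<open>Because f^2 - g^2 = (f - g)(f + g), the difference of two solutions solves a homogeneous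
  linear equation with zero initial value.\<close>

lemma riccati_unique:
  fixes f g :: "'a::{idom, semiring_char_0} fps"
  assumes "2 * fps_deriv f = a * f + b * (f\<^sup>2 + 1)" "2 * fps_deriv g = a * g + b * (g\<^sup>2 + 1)"
    and "f $ 0 = g $ 0"
  shows "f = g"
proof -
  have "2 * fps_deriv (f - g) = (f - g) * (a + b * (f + g))"
    using assms(1,2) by (simp add: algebra_simps power2_eq_square)
  then have "f - g = 0"
    by (rule fps_linear_ode_eq_0[where a = 2]) (use assms(3) in \<open>auto simp: numeral_fps_const\<close>)
  then show ?thesis by simp
qed

section \<open>The closed form solves the equation\<close>

lemma fps_deriv_exp_fps: "fps_deriv (fps_exp (r :: real fps)) = fps_const r * fps_exp r"
proof (rule fps_ext)
  fix n
  have "(of_nat (Suc n) :: real fps) * fps_const (1 / fact (Suc n)) = fps_const (1 / fact n)"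
    by (simp add: of_nat_fps_const del: of_nat_Suc)
  then have "of_nat (Suc n) * (fps_const (1 / fact (Suc n)) * r ^ Suc n) =
      r * (fps_const (1 / fact n) * r ^ n)"
    by (simp only: mult.assoc[symmetric]) (simp only: power_Suc mult_ac)
  then show "fps_deriv (fps_exp r) $ n = (fps_const r * fps_exp r) $ n"
    by (simp only: fps_deriv_nth Suc_eq_plus1[symmetric] fps_exp_nth_fps fps_mult_left_const_nth)
qed

theorem theorem2p4:
  fixes r :: "real fps"
  assumes "r = fps_radical root 2 (1 - 2 * fps_X)"
  shows "Abs_fps (\<lambda>n. (\<Sum>p\<in>jacobi_perms n. fps_X ^ asc p) / fact n) =
    1 + 2 * (fps_exp r - 1) / (1 + fps_const r + (fps_const r - 1) * fps_exp r)"
proof -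
  define R where "R = fps_const r"
  define e where "e = fps_exp r"
  define D where "D = 1 + R + (R - 1) * e"
  define F where "F = 1 + 2 * (e - 1) / D"
  define T :: "real fps fps" where "T = fps_const fps_X"
  \<comment> \<open>This makes \<open>D\<close> a unit, so the quotient in \<open>F\<close> is a
    true quotient.\<close>
  have D00: "D $ 0 $ 0 = 2"
    using denominator_nth_0_0[OF assms] by (simp add: D_def R_def e_def)
  then have "2 * (e - 1) / D * D = 2 * (e - 1)"
    by (intro fps_fps_divide_unit) simp
  then have FD: "F * D = R - 1 + (R + 1) * e"
    unfolding F_def D_def by algebra
  have "D \<noteq> 0" using D00 by auto
  have e': "fps_deriv e = R * e"
    by (simp add: e_def R_def fps_deriv_exp_fps)
  have R': "fps_deriv R = 0" by (simp add: R_def del: fps_deriv_eq_0_iff)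
  have D': "fps_deriv D = (R - 1) * (R * e)"
    by (simp add: D_def e' R' del: fps_deriv_eq_0_iff)
  \<comment> \<open>The product rule for \<open>F * D\<close> yields the derivative of
    \<open>F\<close> without a quotient rule.\<close>
  have "fps_deriv (F * D) = (R + 1) * (R * e)"
    unfolding FD by (simp add: e' R' del: fps_deriv_eq_0_iff)
  then have FD': "fps_deriv F * D + F * ((R - 1) * (R * e)) = (R + 1) * (R * e)"
    by (simp add: D' algebra_simps)
  have "r\<^sup>2 = 1 - 2 * fps_X" using assms fps_radical_square by simp
  then have "fps_const (r\<^sup>2) = fps_const (1 - 2 * fps_X)" by simp
  \<comment> \<open>The only link between \<open>R\<close> and t: it turns 1 + R^2 into 2 - 2 T and
    1 - R^2 into 2 T.\<close>
  then have R2: "R\<^sup>2 = 1 - 2 * T"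
    by (simp add: R_def T_def numeral_fps_const flip: fps_const_sub)
  define N where "N = R - 1 + (R + 1) * e"
  \<comment> \<open>The Riccati equation is checked after multiplication by
    \<open>2 * D\<^sup>2\<close>, where everything is a polynomial in \<open>R\<close> and
    \<open>e\<close>.\<close>
  have "2 * D\<^sup>2 * (2 * fps_deriv F) = 4 * D * (fps_deriv F * D)"
    by (simp add: power2_eq_square)
  also have "fps_deriv F * D = R * e * (R + 1 - F * (R - 1))"
    using FD' by (simp add: algebra_simps)
  also have "4 * D * (R * e * (R + 1 - F * (R - 1))) =
      4 * R * e * ((R + 1) * D - (R - 1) * (F * D))"
    by (simp add: algebra_simps)
  \<comment> \<open>With \<open>F * D\<close> replaced by \<open>N\<close>, both sides expand to 16
    R^2 e.\<close>
  also have "\<dots> = 2 * (1 + R\<^sup>2) * (D * N) + (1 - R\<^sup>2) * (N\<^sup>2 + D\<^sup>2)"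
    unfolding FD unfolding N_def D_def by algebra
  also have "\<dots> = 2 * D\<^sup>2 * ((2 - 2 * T) * F + T * (F\<^sup>2 + 1))"
    unfolding R2 N_def FD[symmetric] by (simp add: algebra_simps power2_eq_square)
  finally have "2 * fps_deriv F = (2 - 2 * T) * F + T * (F\<^sup>2 + 1)"
    using mult_left_cancel[of "2 * D\<^sup>2", THEN iffD1] \<open>D \<noteq> 0\<close>
    by (metis mult_eq_0_iff power_eq_0_iff zero_neq_numeral)
  moreover have "F $ 0 = 1"
  proof -
    have "D $ 0 \<noteq> 0" using D00 by auto
    \<comment> \<open>At x = 0 the exponential is 1, so \<open>D\<close> and \<open>F * D\<close>
      both have constant term 2 r.\<close>
    have "F $ 0 * D $ 0 = D $ 0"
      using arg_cong[OF FD, of "\<lambda>h. h $ 0"] by (simp add: D_def e_def fps_exp_nth_fps)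
    then show ?thesis using \<open>D $ 0 \<noteq> 0\<close> by simp
  qed
  ultimately have "jacobi_gf = F"
    using riccati_unique[OF jacobi_gf_riccati, of F] by (simp only: T_def jacobi_gf_nth_0)
  moreover have "jacobi_gf = Abs_fps (\<lambda>n. (\<Sum>p\<in>jacobi_perms n. fps_X ^ asc p) / fact n)"
    by (simp add: jacobi_gf_def fps_divide_fact asc_poly_def jacobi_perms_of_set_def
        jacobi_perms_def)
  ultimately show ?thesis
    by (simp add: F_def D_def e_def R_def)
qed

end
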